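(* If $H\in\{K_3,\overline{K_3},K_{1,2},\overline{K_{1,2}}\}$, then for every positive integer $n$, $$\mathrm{Dist}(n,\mathrm{Forb}(n,H))=\binom{\lceil n/2\rceil}{2}+\binom{\lfloor n/2\rfloor}{2}.$$
   Context: An edge-operation is the deletion of an existing edge or the addition of a non-existing edge. For an $n$-vertex graph $G$ and a family $\mathcal H$ of $n$-vertex graphs, $\mathrm{Dist}(G,\mathcal H)$ is the minimum of $|E(G)\,\Delta\,E(G')|$ over graphs $G'$ on vertex set $V(G)$ isomorphic to a member of $\mathcal H$, and $\mathrm{Dist}(n,\mathcal H)=\max\{\mathrm{Dist}(G,\mathcal H):|V(G)|=n\}$. $\mathrm{Forb}(n,H)$ is the set of $n$-vertex graphs with no induced subgraph isomorphic to $H$. $\overline{G}$ denotes the complement of $G$. *)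

theory Defs
  imports Complex_Main
begin

record 'a ugraph =
  verts :: "'a set"
  edges :: "'a set set"

definition all_edges :: "'a set \<Rightarrow> 'a set set" where
  "all_edges V = {e. e \<subseteq> V \<and> card e = 2}"

definition is_graph :: "'a ugraph \<Rightarrow> bool" where
  "is_graph G \<longleftrightarrow> finite (verts G) \<and> edges G \<subseteq> all_edges (verts G)"

definition graphs_of_order :: "nat \<Rightarrow> 'a ugraph set" where
  "graphs_of_order n = {G. is_graph G \<and> card (verts G) = n}"

definition isomorphic :: "'a ugraph \<Rightarrow> 'b ugraph \<Rightarrow> bool" where
  "isomorphic G H \<longleftrightarrow>
     (\<exists>f. bij_betw f (verts G) (verts H) \<and> (\<lambda>e. f ` e) ` edges G = edges H)"

definition induced_subgraph :: "'a ugraph \<Rightarrow> 'a set \<Rightarrow> 'a ugraph" where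
  "induced_subgraph G S = \<lparr>verts = S, edges = {e \<in> edges G. e \<subseteq> S}\<rparr>"

definition complement_graph :: "'a ugraph \<Rightarrow> 'a ugraph" where
  "complement_graph G = \<lparr>verts = verts G, edges = all_edges (verts G) - edges G\<rparr>"

definition complete_graph :: "nat \<Rightarrow> nat ugraph" where
  "complete_graph k = \<lparr>verts = {..<k}, edges = all_edges {..<k}\<rparr>"

definition complete_bipartite_graph :: "nat \<Rightarrow> nat \<Rightarrow> nat ugraph" where
  "complete_bipartite_graph a b =
     \<lparr>verts = {..<a + b}, edges = {{i, j} | i j. i \<in> {..<a} \<and> j \<in> {a..<a + b}}\<rparr>"

definition Forb :: "nat \<Rightarrow> 'b ugraph \<Rightarrow> 'a ugraph set" where
  "Forb n H =
     {G \<in> graphs_of_order n. \<not> (\<exists>S \<subseteq> verts G. isomorphic (induced_subgraph G S) H)}"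

(* Min and Max below are over finite sets whenever G is a finite graph and the family contains
   a graph of the same order; they are unspecified for a family containing none. *)

definition Dist_graph :: "'a ugraph \<Rightarrow> 'b ugraph set \<Rightarrow> nat" where
  "Dist_graph G \<H> =
     Min {card (sym_diff (edges G) (edges G')) | G'.
            is_graph G' \<and> verts G' = verts G \<and> (\<exists>F \<in> \<H>. isomorphic G' F)}"

(* Vertices are natural numbers: up to isomorphism every finite graph is of this form. *)
definition Dist :: "nat \<Rightarrow> nat ugraph set \<Rightarrow> nat" where
  "Dist n \<H> = Max {Dist_graph G \<H> | G :: nat ugraph. G \<in> graphs_of_order n}"

end

theory Submission
  imports Defs
begin

text \<open>
  Complementing both graphs preserves distances, so only $K_3$ and $K_{1,2}$ matter. Write $f(n)$
  for the claimed value; then $f(n+1) = f(n) + \lfloor n/2\rfloor$ and $f(n+2) = f(n) + n$.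

  Upper bounds. For $K_3$, delete the edges inside the two halves of a balanced bipartition. For
  $K_{1,2}$, whose induced-free graphs are the disjoint unions of cliques, either some vertex of the
  $(n+1)$-vertex graph has degree at most $\lfloor n/2\rfloor$ and is isolated, or there are so many
  edges that completing the graph is cheap enough.

  Lower bounds. The extremal graphs are $K_n$ and the balanced complete bipartite graph. In both
  cases, if $G'$ has a suitable edge $uv$ (for $K_{1,2}$: one across the bipartition), every other
  vertex is joined by a changed pair to $u$ or to $v$, and removing $u$ and $v$ gives an induction
  in steps of two.
\<close>

section \<open>The extremal function\<close>

text \<open>The number of pairs inside the parts of a balanced bipartition of n points, which is
  also the integer part of (n - 1)^2 / 4.\<close>

definition halves_choose_two :: "nat \<Rightarrow> nat" where
  "halves_choose_two n = ((n + 1) div 2 choose 2) + (n div 2 choose 2)"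

lemma Suc_choose_two: "Suc n choose 2 = (n choose 2) + n"
  by (simp add: numeral_2_eq_2)

lemma double_choose_two: "2 * (n choose 2) = n * (n - 1)"
  by (induction n) (auto simp: Suc_choose_two algebra_simps numeral_2_eq_2 split: nat_diff_split)

lemma halves_choose_two_Suc:
  "halves_choose_two (Suc n) = halves_choose_two n + n div 2"
  by (simp add: halves_choose_two_def Suc_choose_two)

lemma halves_choose_two_add_2:
  "halves_choose_two (Suc (Suc n)) = halves_choose_two n + n"
  by (simp add: halves_choose_two_Suc)

text \<open>The bound n(n - 2)/4 in integral form, for the dense case of
  \<open>cluster_upper\<close>. Passing from m to m + 2 adds 4m + 4 to both sides.\<close>

lemma square_le_halves_choose_two: "n * n \<le> 4 * halves_choose_two n + 2 * n"
proof (induction n rule: nat_less_induct)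
  case (1 n)
  consider "n = 0" | "n = 1" | m where "n = Suc (Suc m)"
    by (metis One_nat_def not0_implies_Suc)
  then show ?case
  proof cases
    case 3
    then have "m * m \<le> 4 * halves_choose_two m + 2 * m" using 1 by auto
    then show ?thesis using 3 by (simp add: halves_choose_two_add_2)
  qed auto
qed

text \<open>The right side is the size of the balanced complete bipartite graph. From m to m + 2
  both factors grow by one and the product by m + 1, while the left side grows by m.\<close>

lemma halves_choose_two_le_prod:
  "halves_choose_two n \<le> ((n + 1) div 2) * (n div 2)"
proof (induction n rule: nat_less_induct)
  case (1 n)
  consider "n = 0" | "n = 1" | m where "n = Suc (Suc m)"
    by (metis One_nat_def not0_implies_Suc)
  then show ?case
  proof cases
    case 3
    then have "halves_choose_two m \<le> ((m + 1) div 2) * (m div 2)" using 1 by auto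
    moreover have "(m + 1) div 2 + m div 2 = m" by presburger
    ultimately show ?thesis using 3 by (simp add: halves_choose_two_add_2)
  qed (auto simp: halves_choose_two_def numeral_2_eq_2)
qed

lemma halves_choose_two_le_choose: "halves_choose_two n \<le> n choose 2"
proof (induction n)
  case 0
  then show ?case by (simp add: halves_choose_two_def)
next
  case (Suc n)
  have "n div 2 \<le> n" by simp
  then show ?case using Suc unfolding halves_choose_two_Suc Suc_choose_two by linarith
qed

lemma halves_choose_two_real:
  "(nat \<lceil>real n / 2\<rceil> choose 2) + (nat \<lfloor>real n / 2\<rfloor> choose 2) = halves_choose_two n"
proof -
  have "nat \<lfloor>real n / 2\<rfloor> = n div 2"
    by (metis floor_divide_of_nat_eq nat_int of_nat_numeral)
  moreover have "\<lceil>real n / 2\<rceil> = int ((n + 1) div 2)"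
    by (rule ceiling_unique) linarith+
  ultimately show ?thesis by (simp add: halves_choose_two_def)
qed

section \<open>Edge sets\<close>

lemma finite_all_edges: "finite V \<Longrightarrow> finite (all_edges V)"
  by (rule finite_subset[of _ "Pow V"]) (auto simp: all_edges_def)

lemma card_all_edges: "finite V \<Longrightarrow> card (all_edges V) = card V choose 2"
  by (simp add: all_edges_def n_subsets)

lemma all_edges_mono: "A \<subseteq> B \<Longrightarrow> all_edges A \<subseteq> all_edges B"
  by (auto simp: all_edges_def)

lemma pair_in_all_edges_iff: "{x, y} \<in> all_edges V \<longleftrightarrow> x \<in> V \<and> y \<in> V \<and> x \<noteq> y"
  by (auto simp: all_edges_def card_insert_if)

lemma all_edges_cases:
  assumes "e \<in> all_edges V"
  obtains x y where "e = {x, y}" "x \<in> V" "y \<in> V" "x \<noteq> y"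
  using assms unfolding all_edges_def card_2_iff by blast

text \<open>Handshake identity: incidences are counted in both orders, and each edge contributes
  two.\<close>

lemma sum_degrees:
  assumes "finite V" "E \<subseteq> all_edges V"
  shows "(\<Sum>v\<in>V. card {e \<in> E. v \<in> e}) = 2 * card E"
proof -
  have "finite E" using assms finite_all_edges finite_subset by blast
  have "(\<Sum>v\<in>V. card {e \<in> E. v \<in> e}) = (\<Sum>v\<in>V. \<Sum>e\<in>E. if v \<in> e then 1 else 0)"
    using \<open>finite E\<close> by (simp add: sum.If_cases Int_def)
  also have "\<dots> = (\<Sum>e\<in>E. \<Sum>v\<in>V. if v \<in> e then 1 else 0)" by (rule sum.swap)
  also have "\<dots> = (\<Sum>e\<in>E. 2)"
  proof (rule sum.cong)
    fix e assume "e \<in> E"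
    then have "e \<subseteq> V" "card e = 2" using assms(2) by (auto simp: all_edges_def)
    then show "(\<Sum>v\<in>V. if v \<in> e then 1 else 0) = (2::nat)"
      using assms(1) by (simp add: sum.If_cases Int_absorb1)
  qed simp
  finally show ?thesis by simp
qed

text \<open>The induction step shared by both lower bounds, with \<open>D\<close> the set of changed
  pairs. Each remaining vertex supplies a changed pair not contained in \<open>V - {u, v}\<close>,
  and their number is the increment in \<open>halves_choose_two_add_2\<close>.\<close>

lemma card_ge_after_removing_pair:
  assumes "finite V" "D \<subseteq> all_edges V" "u \<in> V" "v \<in> V" "u \<noteq> v"
    and hit: "\<And>w. w \<in> V - {u, v} \<Longrightarrow> {u, w} \<in> D \<or> {v, w} \<in> D"
  shows "card (D \<inter> all_edges (V - {u, v})) + (card V - 2) \<le> card D"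
proof -
  have "finite D" using assms finite_all_edges finite_subset by blast
  \<comment> \<open>One changed pair per \<open>w\<close>. As \<open>w\<close> is its only element
    outside \<open>{u, v}\<close>, distinct vertices get distinct pairs.\<close>
  define g where "g w = (if {u, w} \<in> D then {u, w} else {v, w})" for w
  have "inj_on g (V - {u, v})"
    by (auto simp: inj_on_def g_def doubleton_eq_iff split: if_splits)
  then have "card (g ` (V - {u, v})) = card V - 2"
    using assms by (simp add: card_image card_Diff_subset)
  moreover have "g ` (V - {u, v}) \<inter> all_edges (V - {u, v}) = {}"
    by (auto simp: g_def pair_in_all_edges_iff)
  moreover have "g ` (V - {u, v}) \<subseteq> D" using hit by (auto simp: g_def)
  moreover have "card (D \<inter> all_edges (V - {u, v}) \<union> g ` (V - {u, v}))
      = card (D \<inter> all_edges (V - {u, v})) + card (g ` (V - {u, v}))"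
    using calculation(2) \<open>finite D\<close> \<open>finite V\<close> by (intro card_Un_disjoint) auto
  ultimately show ?thesis
    using card_mono[OF \<open>finite D\<close>, of "D \<inter> all_edges (V - {u, v}) \<union> g ` (V - {u, v})"]
    by auto
qed

section \<open>Triangle-free graphs\<close>

text \<open>Within \<open>all_edges V\<close> the three memberships already force x, y, z to be
  distinct.\<close>

definition triangle_free :: "'a set set \<Rightarrow> bool" where
  "triangle_free E \<longleftrightarrow> (\<forall>x y z. \<not> ({x, y} \<in> E \<and> {x, z} \<in> E \<and> {y, z} \<in> E))"

lemma triangle_free_upper:
  assumes "finite V" "E \<subseteq> all_edges V"
  obtains E' where "E' \<subseteq> all_edges V" "triangle_free E'"
    "card (sym_diff E E') \<le> halves_choose_two (card V)"
proof -
  obtain A where A: "A \<subseteq> V" "card A = (card V + 1) div 2"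
  proof -
    have "(card V + 1) div 2 \<le> card V" by presburger
    then show ?thesis using that by (metis obtain_subset_with_card_n)
  qed
  define B where "B = V - A"
  have fin: "finite A" "finite B" using A assms(1) finite_subset by (auto simp: B_def)
  have cB: "card B = card V div 2"
    using A fin by (simp add: B_def card_Diff_subset)
  define E' where "E' = E - (all_edges A \<union> all_edges B)"
  have sub: "E' \<subseteq> all_edges V" using assms(2) by (auto simp: E'_def)
  have "triangle_free E'"
    unfolding triangle_free_def
  proof (intro allI notI, elim conjE)
    fix x y z assume *: "{x, y} \<in> E'" "{x, z} \<in> E'" "{y, z} \<in> E'"
    then have "x \<in> V" "y \<in> V" "z \<in> V" "x \<noteq> y" "x \<noteq> z" "y \<noteq> z"
      using sub by (metis pair_in_all_edges_iff subsetD)+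
    \<comment> \<open>Two of the three vertices fall in the same part, and the pair joining them was
      deleted.\<close>
    then show False using * by (auto simp: E'_def B_def pair_in_all_edges_iff)
  qed
  moreover have "card (sym_diff E E') \<le> card (all_edges A \<union> all_edges B)"
    using fin by (intro card_mono) (auto simp: E'_def finite_all_edges)
  moreover have "\<dots> \<le> card (all_edges A) + card (all_edges B)" by (rule card_Un_le)
  ultimately show thesis
    using that[OF sub] by (simp add: card_all_edges fin A cB halves_choose_two_def)
qed

text \<open>\<open>all_edges V - E\<close> is the set of deletions that turn the complete graph on
  \<open>V\<close> into \<open>E\<close>. The induction is strong because the two ends of an edge
  are removed together.\<close>

lemma triangle_free_lower:
  assumes "finite V" "E \<subseteq> all_edges V" "triangle_free E"
  shows "halves_choose_two (card V) \<le> card (all_edges V - E)"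
  using assms
proof (induction "card V" arbitrary: V E rule: less_induct)
  case less
  show ?case
  proof (cases "E = {}")
    case True
    then show ?thesis
      using less.prems by (simp add: card_all_edges halves_choose_two_le_choose)
  next
    case False
    then obtain u v where uv: "{u, v} \<in> E" "u \<in> V" "v \<in> V" "u \<noteq> v"
      using less.prems(2) by (metis all_edges_cases ex_in_conv subsetD)
    define W where "W = V - {u, v}"
    have "2 \<le> card V" using uv less.prems(1) by (metis card_2_iff card_mono empty_subsetI insert_subset)
    moreover have cW: "card W = card V - 2"
      using uv less.prems(1) by (simp add: W_def card_Diff_subset)
    ultimately have cV: "card V = Suc (Suc (card W))" by simp
    have "halves_choose_two (card W) \<le> card (all_edges W - E \<inter> all_edges W)"
    proof (rule less.hyps)
      show "triangle_free (E \<inter> all_edges W)"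
        using less.prems(3) unfolding triangle_free_def by blast
    qed (use less.prems(1) cV in \<open>simp_all add: W_def\<close>)
    also have "all_edges W - E \<inter> all_edges W = (all_edges V - E) \<inter> all_edges W"
      using all_edges_mono[of W V] by (auto simp: W_def)
    finally have "halves_choose_two (card W) \<le> card ((all_edges V - E) \<inter> all_edges W)" .
    moreover have "card ((all_edges V - E) \<inter> all_edges W) + (card V - 2) \<le> card (all_edges V - E)"
      unfolding W_def
    proof (rule card_ge_after_removing_pair)
      \<comment> \<open>If both pairs were kept, u, v, w would form a triangle.\<close>
      fix w assume "w \<in> V - {u, v}"
      then show "{u, w} \<in> all_edges V - E \<or> {v, w} \<in> all_edges V - E"
        using uv less.prems(3) by (auto simp: pair_in_all_edges_iff triangle_free_def)
    qed (use uv less.prems in auto)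
    ultimately show ?thesis by (simp add: cV halves_choose_two_add_2)
  qed
qed

section \<open>Disjoint unions of cliques\<close>

text \<open>No induced path on three vertices with centre \<open>x\<close>; equivalently, adjacency
  extended by equality is transitive. The case y = z is excluded since \<open>{y, y}\<close> is
  never an edge.\<close>

definition cluster :: "'a set set \<Rightarrow> bool" where
  "cluster E \<longleftrightarrow> (\<forall>x y z. {x, y} \<in> E \<longrightarrow> {x, z} \<in> E \<longrightarrow> y \<noteq> z \<longrightarrow> {y, z} \<in> E)"

lemma cluster_upper:
  assumes "finite V" "E \<subseteq> all_edges V"
  shows "\<exists>E' \<subseteq> all_edges V. cluster E' \<and> card (sym_diff E E') \<le> halves_choose_two (card V)"
  using assms
proof (induction "card V" arbitrary: V E)
  case 0
  then have "E = {}" by (auto simp: all_edges_def)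
  then show ?case by (intro exI[of _ "{}"]) (simp add: cluster_def)
next
  case (Suc n)
  have finE: "finite E" using Suc.prems finite_all_edges finite_subset by blast
  show ?case
  \<comment> \<open>The threshold \<open>n div 2\<close> is the increment in
    \<open>halves_choose_two_Suc\<close>, hence exactly the amount that may be spent at one
    vertex.\<close>
  proof (cases "\<exists>v\<in>V. card {e \<in> E. v \<in> e} \<le> n div 2")
    case True
    then obtain v where v: "v \<in> V" "card {e \<in> E. v \<in> e} \<le> n div 2" by blast
    define W where "W = V - {v}"
    have W: "finite W" "card W = n" using Suc v by (auto simp: W_def)
    obtain E' where E': "E' \<subseteq> all_edges W" "cluster E'"
      "card (sym_diff (E \<inter> all_edges W) E') \<le> halves_choose_two n"
      using Suc.hyps(1)[of W "E \<inter> all_edges W"] W by auto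
    \<comment> \<open>\<open>E'\<close> has no edge at \<open>v\<close>, which becomes a singleton
      clique. The changes are those inside \<open>W\<close> and the deleted edges at
      \<open>v\<close>.\<close>
    have "sym_diff E E' \<subseteq> sym_diff (E \<inter> all_edges W) E' \<union> {e \<in> E. v \<in> e}"
      using Suc.prems(2) by (auto simp: W_def all_edges_def)
    then have "card (sym_diff E E') \<le> card (sym_diff (E \<inter> all_edges W) E' \<union> {e \<in> E. v \<in> e})"
      using finE E'(1) finite_all_edges[OF W(1)] by (intro card_mono) (auto dest: finite_subset)
    also have "\<dots> \<le> card (sym_diff (E \<inter> all_edges W) E') + card {e \<in> E. v \<in> e}"
      by (rule card_Un_le)
    also have "\<dots> \<le> halves_choose_two (Suc n)"
      using E'(3) v(2) by (simp add: halves_choose_two_Suc)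
    finally show ?thesis
      using E'(1,2) all_edges_mono[of W V] Suc.hyps(2) by (auto simp: W_def intro!: exI[of _ E'])
  next
    case False
    \<comment> \<open>Every degree is at least \<open>Suc (n div 2)\<close>, hence at least (n +
      1)/2, so 4|E| is at least (n + 1)^2.\<close>
    have "card V * Suc (n div 2) \<le> (\<Sum>v\<in>V. card {e \<in> E. v \<in> e})"
      using False sum_bounded_below[of V "Suc (n div 2)" "\<lambda>v. card {e \<in> E. v \<in> e}"]
      by (auto simp: not_le Suc_le_eq)
    then have "Suc n * Suc (n div 2) \<le> 2 * card E"
      using Suc sum_degrees by metis
    then have "Suc n * (2 * Suc (n div 2)) \<le> 4 * card E" by simp
    moreover have "Suc n * Suc n \<le> Suc n * (2 * Suc (n div 2))"
      by (intro mult_le_mono2) presburger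
    ultimately have "Suc n * Suc n \<le> 4 * card E" by linarith
    \<comment> \<open>Completing the graph costs its non-edges. Four times their number is 2n(n + 1)
      - 4|E|, at most (n + 1)^2 - 2(n + 1), which \<open>square_le_halves_choose_two\<close> bounds
      by four times the claimed value.\<close>
    moreover have "card (sym_diff E (all_edges V)) + card E = Suc n choose 2"
    proof -
      have "sym_diff E (all_edges V) = all_edges V - E" using Suc.prems by auto
      then show ?thesis
        using Suc.prems Suc.hyps(2) finE card_mono[OF finite_all_edges, of V E]
        by (simp add: card_Diff_subset card_all_edges)
    qed
    moreover have "2 * (Suc n choose 2) = Suc n * n" using double_choose_two[of "Suc n"] by simp
    moreover have "Suc n * Suc n \<le> 4 * halves_choose_two (Suc n) + 2 * Suc n"
      by (rule square_le_halves_choose_two)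
    ultimately have "card (sym_diff E (all_edges V)) \<le> halves_choose_two (Suc n)"
      by (simp add: algebra_simps)
    then show ?thesis
      using Suc.hyps(2)
      by (intro exI[of _ "all_edges V"]) (auto simp: cluster_def pair_in_all_edges_iff)
  qed
qed

section \<open>Complete bipartite graphs and the lower bound for unions of cliques\<close>

text \<open>The parts are arbitrary sets, since the induction in \<open>cluster_lower\<close>
  deletes a vertex from each.\<close>

definition cross_edges :: "'a set \<Rightarrow> 'a set \<Rightarrow> 'a set set" where
  "cross_edges A B = {{x, y} | x y. x \<in> A \<and> y \<in> B}"

lemma card_cross_edges:
  assumes "A \<inter> B = {}"
  shows "card (cross_edges A B) = card A * card B"
proof -
  have "cross_edges A B = (\<lambda>(x, y). {x, y}) ` (A \<times> B)" by (auto simp: cross_edges_def)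
  moreover have "inj_on (\<lambda>(x, y). {x, y}) (A \<times> B)"
    using assms by (auto simp: inj_on_def doubleton_eq_iff)
  ultimately show ?thesis by (simp add: card_image card_cartesian_product)
qed

lemma cross_edges_subset: "A \<inter> B = {} \<Longrightarrow> cross_edges A B \<subseteq> all_edges (A \<union> B)"
  by (auto simp: cross_edges_def pair_in_all_edges_iff)

lemma pair_in_cross_edges_iff:
  "{x, y} \<in> cross_edges A B \<longleftrightarrow> x \<in> A \<and> y \<in> B \<or> y \<in> A \<and> x \<in> B"
  unfolding cross_edges_def by (auto simp: doubleton_eq_iff)

text \<open>Balanced parts stay balanced when each loses one vertex, so the induction goes from n to
  n - 2 by removing a cross edge uv of \<open>E\<close>. In \<open>E\<close>, u and v have the same
  other neighbours; in the bipartite graph every other vertex is adjacent to exactly one of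
  them.\<close>

lemma cluster_lower:
  assumes "finite A" "finite B" "A \<inter> B = {}" "card A = (n + 1) div 2" "card B = n div 2"
    and "E \<subseteq> all_edges (A \<union> B)" "cluster E"
  shows "halves_choose_two n \<le> card (sym_diff (cross_edges A B) E)"
  using assms
proof (induction n arbitrary: A B E rule: less_induct)
  case (less n)
  have fin: "finite (sym_diff (cross_edges A B) E)"
    using less.prems cross_edges_subset[of A B] finite_all_edges[of "A \<union> B"]
    by (auto dest: finite_subset)
  show ?case
  proof (cases "E \<inter> cross_edges A B = {}")
    \<comment> \<open>Every cross edge has been deleted.\<close>
    case True
    have "halves_choose_two n \<le> card (cross_edges A B)"
      using less.prems halves_choose_two_le_prod[of n] by (simp add: card_cross_edges)
    also have "\<dots> \<le> card (sym_diff (cross_edges A B) E)"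
      using True fin by (intro card_mono) auto
    finally show ?thesis .
  next
    case False
    then obtain u v where uv: "{u, v} \<in> E" "u \<in> A" "v \<in> B"
      by (auto simp: cross_edges_def)
    then have "u \<notin> B" "v \<notin> A" "u \<noteq> v" using less.prems by auto
    define W where "W = A \<union> B - {u, v}"
    have W: "W = (A - {u}) \<union> (B - {v})"
      using \<open>u \<notin> B\<close> \<open>v \<notin> A\<close> by (auto simp: W_def)
    have "card B \<noteq> 0" using uv less.prems by auto
    then have "2 \<le> n" using less.prems by auto
    then obtain m where n: "n = Suc (Suc m)" by (metis add_2_eq_Suc le_Suc_ex)
    have "halves_choose_two m \<le> card (sym_diff (cross_edges (A - {u}) (B - {v})) (E \<inter> all_edges W))"
    proof (rule less.IH)
      show "cluster (E \<inter> all_edges W)"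
        using less.prems(7) by (auto simp: cluster_def pair_in_all_edges_iff)
    qed (use less.prems(1-5) uv n W in auto)
    also have "sym_diff (cross_edges (A - {u}) (B - {v})) (E \<inter> all_edges W)
        = sym_diff (cross_edges A B) E \<inter> all_edges W"
    proof -
      \<comment> \<open>Forming cross edges commutes with restriction to \<open>W\<close>, so the
        induction hypothesis counts the changes inside \<open>W\<close>.\<close>
      have "cross_edges (A - {u}) (B - {v}) = cross_edges A B \<inter> all_edges W"
      proof (rule set_eqI)
        fix e
        show "e \<in> cross_edges (A - {u}) (B - {v}) \<longleftrightarrow> e \<in> cross_edges A B \<inter> all_edges W"
        proof
          assume "e \<in> cross_edges A B \<inter> all_edges W"
          then obtain x y where "e = {x, y}" "x \<in> W" "y \<in> W" "{x, y} \<in> cross_edges A B"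
            by (metis IntD1 IntD2 all_edges_cases)
          then show "e \<in> cross_edges (A - {u}) (B - {v})"
            by (auto simp: pair_in_cross_edges_iff W_def)
        qed (use less.prems(3) W in \<open>auto simp: cross_edges_def pair_in_all_edges_iff\<close>)
      qed
      then show ?thesis by auto
    qed
    finally have "halves_choose_two m \<le> card (sym_diff (cross_edges A B) E \<inter> all_edges W)" .
    moreover have "card (sym_diff (cross_edges A B) E \<inter> all_edges W) + (card (A \<union> B) - 2)
        \<le> card (sym_diff (cross_edges A B) E)"
      unfolding W_def
    proof (rule card_ge_after_removing_pair)
      fix w assume w: "w \<in> A \<union> B - {u, v}"
      \<comment> \<open>The clique condition is applied with centre u in one direction and centre v
        in the other.\<close>
      have "{v, u} \<in> E" using uv by (simp add: insert_commute)
      then have "{u, w} \<in> E \<longleftrightarrow> {v, w} \<in> E"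
        using uv(1) w less.prems(7) unfolding cluster_def by blast
      \<comment> \<open>\<open>w\<close> lies in exactly one part, so it is joined across to exactly
        one of u and v.\<close>
      moreover have "{u, w} \<in> cross_edges A B \<longleftrightarrow> {v, w} \<notin> cross_edges A B"
        using w uv \<open>u \<notin> B\<close> \<open>v \<notin> A\<close> less.prems(3) by (auto simp: pair_in_cross_edges_iff)
      ultimately show "{u, w} \<in> sym_diff (cross_edges A B) E \<or> {v, w} \<in> sym_diff (cross_edges A B) E"
        by blast
    qed (use uv less.prems cross_edges_subset[of A B] \<open>u \<noteq> v\<close> in auto)
    moreover have "card (A \<union> B) = n"
      using less.prems by (simp add: card_Un_disjoint)
    ultimately show ?thesis by (simp add: n halves_choose_two_add_2)
  qed
qed

section \<open>Isomorphism and complementation\<close>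

lemma isomorphic_refl: "isomorphic G G"
  unfolding isomorphic_def by (intro exI[of _ id]) simp

text \<open>Edges lie inside \<open>V\<close>, where \<open>f\<close> is injective, so the inverse
  undoes \<open>f\<close> edge by edge.\<close>

lemma image_inv_image_edges:
  assumes "bij_betw f V W" "E \<subseteq> all_edges V"
  shows "(`) (inv_into V f) ` (`) f ` E = E"
proof -
  have "inv_into V f ` f ` e = e" if "e \<in> E" for e
    using that assms by (intro inv_into_image_cancel) (auto simp: bij_betw_def all_edges_def)
  then show ?thesis by (simp add: image_image)
qed

lemma isomorphic_sym:
  assumes "isomorphic G H" "is_graph G"
  shows "isomorphic H G"
proof -
  obtain f where f: "bij_betw f (verts G) (verts H)" "(`) f ` edges G = edges H"
    using assms(1) by (auto simp: isomorphic_def)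
  then show ?thesis
    using image_inv_image_edges[OF f(1), of "edges G"] bij_betw_inv_into[OF f(1)] assms(2)
    unfolding isomorphic_def is_graph_def by metis
qed

lemma isomorphic_trans:
  assumes "isomorphic G H" "isomorphic H K"
  shows "isomorphic G K"
proof -
  obtain f where f: "bij_betw f (verts G) (verts H)" "(`) f ` edges G = edges H"
    using assms(1) by (auto simp: isomorphic_def)
  obtain g where g: "bij_betw g (verts H) (verts K)" "(`) g ` edges H = edges K"
    using assms(2) by (auto simp: isomorphic_def)
  have "(`) (g \<circ> f) ` edges G = edges K" by (simp add: f(2)[symmetric] g(2)[symmetric] image_image image_comp)
  then show ?thesis
    using bij_betw_trans[OF f(1) g(1)] unfolding isomorphic_def by blast
qed

lemma image_all_edges:
  assumes "bij_betw f V W"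
  shows "(`) f ` all_edges V = all_edges W"
proof
  show "(`) f ` all_edges V \<subseteq> all_edges W"
    using assms by (auto simp: all_edges_def bij_betw_def card_image inj_on_subset)
  show "all_edges W \<subseteq> (`) f ` all_edges V"
  proof
    fix e assume "e \<in> all_edges W"
    then obtain x y where e: "e = {x, y}" "x \<in> W" "y \<in> W" "x \<noteq> y" by (rule all_edges_cases)
    then obtain x' y' where "x' \<in> V" "y' \<in> V" "x = f x'" "y = f y'"
      using assms unfolding bij_betw_def by blast
    then show "e \<in> (`) f ` all_edges V"
      using e by (intro image_eqI[of _ _ "{x', y'}"]) (auto simp: pair_in_all_edges_iff)
  qed
qed

lemma isomorphic_complement:
  assumes "isomorphic G H" "is_graph G"
  shows "isomorphic (complement_graph G) (complement_graph H)"
proof -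
  obtain f where f: "bij_betw f (verts G) (verts H)" "(`) f ` edges G = edges H"
    using assms(1) by (auto simp: isomorphic_def)
  \<comment> \<open>Injectivity on 2-element sets lets the image pass through the set
    difference.\<close>
  have "inj_on ((`) f) (all_edges (verts G))"
    using f(1) by (intro inj_on_image) (auto simp: bij_betw_def all_edges_def intro: inj_on_subset)
  then have "(`) f ` (all_edges (verts G) - edges G) = all_edges (verts H) - edges H"
    using assms(2) f by (subst inj_on_image_set_diff) (auto simp: is_graph_def image_all_edges)
  then show ?thesis using f(1) by (auto simp: isomorphic_def complement_graph_def)
qed

lemma is_graph_complement: "is_graph G \<Longrightarrow> is_graph (complement_graph G)"
  by (auto simp: is_graph_def complement_graph_def)

lemma complement_complement:
  fixes G :: "'a ugraph"
  shows "is_graph G \<Longrightarrow> complement_graph (complement_graph G) = G"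
  by (simp add: is_graph_def complement_graph_def double_diff)

lemma verts_complement [simp]: "verts (complement_graph G) = verts G"
  by (simp add: complement_graph_def)

lemma complement_in_graphs_of_order:
  "G \<in> graphs_of_order n \<Longrightarrow> complement_graph G \<in> graphs_of_order n"
  by (simp add: graphs_of_order_def is_graph_complement)

lemma induced_subgraph_complement:
  "S \<subseteq> verts G \<Longrightarrow>
    induced_subgraph (complement_graph G) S = complement_graph (induced_subgraph G S)"
  by (auto simp: induced_subgraph_def complement_graph_def all_edges_def)

lemma is_graph_induced: "is_graph G \<Longrightarrow> S \<subseteq> verts G \<Longrightarrow> is_graph (induced_subgraph G S)"
  by (auto simp: is_graph_def induced_subgraph_def all_edges_def dest: finite_subset)

text \<open>Complementing flips the status of every pair in both graphs, so they still disagree on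
  the same pairs.\<close>

lemma sym_diff_complement:
  assumes "is_graph G" "is_graph G'" "verts G' = verts G"
  shows "sym_diff (edges (complement_graph G)) (edges (complement_graph G'))
    = sym_diff (edges G) (edges G')"
  using assms by (auto simp: is_graph_def complement_graph_def)

text \<open>Complementation commutes with inducing and respects isomorphism, so a forbidden copy in
  the complement would complement back to an induced copy of \<open>H\<close> in
  \<open>G\<close>.\<close>

lemma complement_in_Forb:
  fixes G :: "'a ugraph" and H :: "'b ugraph"
  assumes "G \<in> Forb n H" "is_graph H"
  shows "complement_graph G \<in> Forb n (complement_graph H)"
proof -
  have G: "G \<in> graphs_of_order n" "is_graph G"
    using assms by (auto simp: Forb_def graphs_of_order_def)
  have False if "S \<subseteq> verts G"
    "isomorphic (induced_subgraph (complement_graph G) S) (complement_graph H)" for S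
  proof -
    have "isomorphic (complement_graph (induced_subgraph G S)) (complement_graph H)"
      using that by (simp add: induced_subgraph_complement)
    then have "isomorphic (complement_graph (complement_graph (induced_subgraph G S)))
        (complement_graph (complement_graph H))"
      by (rule isomorphic_complement) (use that G in \<open>simp add: is_graph_complement is_graph_induced\<close>)
    then have "isomorphic (induced_subgraph G S) H"
      using that G assms(2) by (simp add: complement_complement is_graph_induced)
    then show False using that assms(1) by (auto simp: Forb_def)
  qed
  then show ?thesis using complement_in_graphs_of_order[OF G(1)] by (auto simp: Forb_def)
qed

text \<open>Closure under isomorphism reduces the condition in \<open>Dist_graph\<close>, being
  isomorphic to a member, to plain membership.\<close>

lemma Forb_isomorphic:
  assumes "isomorphic G F" "F \<in> Forb n H" "is_graph G"
  shows "G \<in> Forb n H"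
proof -
  obtain f where f: "bij_betw f (verts G) (verts F)" "(`) f ` edges G = edges F"
    using assms(1) by (auto simp: isomorphic_def)
  have "isomorphic (induced_subgraph F (f ` S)) H"
    if S: "S \<subseteq> verts G" and iso: "isomorphic (induced_subgraph G S) H" for S
  proof -
    \<comment> \<open>Injectivity of \<open>f\<close> on the vertices makes containment in
      \<open>S\<close> transfer in both directions.\<close>
    have "f ` e \<subseteq> f ` S \<longleftrightarrow> e \<subseteq> S" if "e \<in> edges G" for e
    proof -
      have "e \<subseteq> verts G" using that assms(3) by (auto simp: is_graph_def all_edges_def)
      then show ?thesis using f(1) S by (auto simp: bij_betw_def inj_on_def) blast
    qed
    then have "(`) f ` {e \<in> edges G. e \<subseteq> S} = {e \<in> edges F. e \<subseteq> f ` S}"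
      unfolding f(2)[symmetric] by auto
    moreover have "bij_betw f S (f ` S)"
      using f(1) S by (meson bij_betw_subset)
    ultimately have "isomorphic (induced_subgraph G S) (induced_subgraph F (f ` S))"
      unfolding isomorphic_def induced_subgraph_def by auto
    then show ?thesis
      using iso S assms(3) by (meson is_graph_induced isomorphic_sym isomorphic_trans)
  qed
  moreover have "f ` S \<subseteq> verts F" if "S \<subseteq> verts G" for S
    using that f(1) by (auto simp: bij_betw_def)
  moreover have "card (verts G) = card (verts F)" using f(1) by (rule bij_betw_same_card)
  ultimately show ?thesis
    using assms(2,3) unfolding Forb_def graphs_of_order_def mem_Collect_eq by metis
qed

section \<open>Three-vertex induced subgraphs\<close>

text \<open>Replaces the search over vertex sets and bijections by three adjacency tests on an
  ordered triple, matched with 0, 1, 2.\<close>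

lemma induced_three_vertices_iff:
  fixes H :: "nat ugraph"
  assumes "is_graph G" "is_graph H" "verts H = {..<3}"
  shows "(\<exists>S \<subseteq> verts G. isomorphic (induced_subgraph G S) H) \<longleftrightarrow>
    (\<exists>x \<in> verts G. \<exists>y \<in> verts G. \<exists>z \<in> verts G. x \<noteq> y \<and> x \<noteq> z \<and> y \<noteq> z \<and>
      ({x, y} \<in> edges G \<longleftrightarrow> {0, 1} \<in> edges H) \<and>
      ({x, z} \<in> edges G \<longleftrightarrow> {0, 2} \<in> edges H) \<and>
      ({y, z} \<in> edges G \<longleftrightarrow> {1, 2} \<in> edges H))" (is "?L \<longleftrightarrow> ?R")
proof
  have three: "{..<3} = {0, 1, 2::nat}" by auto
  {
    assume ?L
    then obtain S where S: "S \<subseteq> verts G" "isomorphic (induced_subgraph G S) H" by blast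
    then have "isomorphic H (induced_subgraph G S)"
      using assms(1) is_graph_induced isomorphic_sym by blast
    then obtain g where g: "bij_betw g {0, 1, 2} S"
      "(`) g ` edges H = {e \<in> edges G. e \<subseteq> S}"
      using assms(3) three by (auto simp: isomorphic_def induced_subgraph_def)
    have "{g i, g j} \<in> edges G \<longleftrightarrow> {i, j} \<in> edges H" if "i \<in> {0, 1, 2}" "j \<in> {0, 1, 2}" for i j
    proof -
      \<comment> \<open>Injectivity on all subsets of the label set transfers non-edges as well as
        edges.\<close>
      have "inj_on ((`) g) (Pow {0, 1, 2})"
        using g(1) by (intro inj_on_image) (auto simp: bij_betw_def)
      moreover have "edges H \<subseteq> Pow {0, 1, 2}"
        using assms(2,3) three by (auto simp: is_graph_def all_edges_def)
      moreover have "{i, j} \<in> Pow {0, 1, 2}" using that by auto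
      ultimately have "g ` {i, j} \<in> (`) g ` edges H \<longleftrightarrow> {i, j} \<in> edges H"
        by (meson inj_on_image_mem_iff)
      moreover have "{g i, g j} \<subseteq> S" using that g(1) by (auto simp: bij_betw_def)
      ultimately show ?thesis using g(2) by auto
    qed
    moreover have "g 0 \<in> verts G" "g 1 \<in> verts G" "g 2 \<in> verts G"
      using g(1) S(1) by (auto simp: bij_betw_def)
    moreover have "g 0 \<noteq> g 1" "g 0 \<noteq> g 2" "g 1 \<noteq> g 2"
      using g(1) by (auto simp: bij_betw_def inj_on_def)
    ultimately show ?R by blast
  }
  assume ?R
  then obtain x y z where xyz: "x \<in> verts G" "y \<in> verts G" "z \<in> verts G"
    "x \<noteq> y" "x \<noteq> z" "y \<noteq> z" and adj:
    "{x, y} \<in> edges G \<longleftrightarrow> {0, 1} \<in> edges H"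
    "{x, z} \<in> edges G \<longleftrightarrow> {0, 2} \<in> edges H"
    "{y, z} \<in> edges G \<longleftrightarrow> {1, 2} \<in> edges H" by blast
  define g where "g i = (if i = 0 then x else if i = 1 then y else z)" for i :: nat
  have g: "g 0 = x" "g 1 = y" "g 2 = z" by (auto simp: g_def)
  \<comment> \<open>Stated over a fresh type because it serves both the labels of \<open>H\<close>
    and the vertices of \<open>G\<close>.\<close>
  have triples: "all_edges {a, b, c} = {{a, b}, {a, c}, {b, c}}"
    if "a \<noteq> b" "a \<noteq> c" "b \<noteq> c" for a b c :: 'c
  proof
    show "all_edges {a, b, c} \<subseteq> {{a, b}, {a, c}, {b, c}}"
      by (auto elim!: all_edges_cases)
  qed (use that in \<open>auto simp: pair_in_all_edges_iff\<close>)
  have "bij_betw g {0, 1, 2} {x, y, z}"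
    using xyz by (auto simp: bij_betw_def inj_on_def g_def)
  moreover have "(`) g ` edges H = {e \<in> edges G. e \<subseteq> {x, y, z}}"
  proof -
    have "edges H = {e \<in> {{0, 1}, {0, 2}, {1, 2}}. e \<in> edges H}"
      using assms(2,3) three triples[of "0::nat" 1 2] by (auto simp: is_graph_def)
    then have "(`) g ` edges H = (`) g ` {e \<in> {{0, 1}, {0, 2}, {1, 2}}. e \<in> edges H}" by simp
    also have "\<dots> = {e \<in> {{x, y}, {x, z}, {y, z}}. e \<in> edges G}"
    proof -
      \<comment> \<open>Both sides split into three conditional singletons, whose conditions agree
        by \<open>adj\<close>.\<close>
      have "{g 0, g 1} = {x, y}" "{g 0, g 2} = {x, z}" "{g 1, g 2} = {y, z}"
        by (simp_all only: g)
      moreover have "(`) g ` {e \<in> {a, b, c}. P e} =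
          (if P a then {g ` a} else {}) \<union> (if P b then {g ` b} else {}) \<union> (if P c then {g ` c} else {})"
        for P a b c by auto
      moreover have "{e \<in> {a, b, c}. Q e} =
          (if Q a then {a} else {}) \<union> (if Q b then {b} else {}) \<union> (if Q c then {c} else {})"
        for Q and a b c :: "'a set" by auto
      ultimately show ?thesis
        by (simp only: image_insert image_empty adj)
    qed
    also have "\<dots> = {e \<in> edges G. e \<subseteq> {x, y, z}}"
    proof -
      have "e \<in> all_edges {x, y, z} \<longleftrightarrow> e \<subseteq> {x, y, z}" if "e \<in> edges G" for e
        using that assms(1) by (auto simp: is_graph_def all_edges_def)
      then show ?thesis using triples[OF xyz(4-6)] by blast
    qed
    finally show ?thesis .
  qed
  ultimately have "isomorphic H (induced_subgraph G {x, y, z})"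
    unfolding isomorphic_def induced_subgraph_def using assms(3) three by auto
  then have "isomorphic (induced_subgraph G {x, y, z}) H"
    using assms(2) by (rule isomorphic_sym)
  then show ?L using xyz by (intro exI[of _ "{x, y, z}"]) auto
qed

lemma is_graph_complete: "is_graph (complete_graph k)"
  by (simp add: is_graph_def complete_graph_def)

lemma is_graph_complete_bipartite: "is_graph (complete_bipartite_graph a b)"
  by (auto simp: is_graph_def complete_bipartite_graph_def pair_in_all_edges_iff)

lemma Forb_complete_3_iff:
  "G \<in> Forb n (complete_graph 3) \<longleftrightarrow> G \<in> graphs_of_order n \<and> triangle_free (edges G)"
proof (cases "G \<in> graphs_of_order n")
  case True
  then have G: "is_graph G" by (simp add: graphs_of_order_def)
  then have E: "{x, y} \<in> edges G \<Longrightarrow> x \<in> verts G \<and> y \<in> verts G \<and> x \<noteq> y" for x y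
    by (metis is_graph_def pair_in_all_edges_iff subsetD)
  have K: "verts (complete_graph 3) = {..<3}" "{0, 1} \<in> edges (complete_graph 3)"
    "{0, 2} \<in> edges (complete_graph 3)" "{1, 2} \<in> edges (complete_graph 3)"
    unfolding complete_graph_def by (auto simp: pair_in_all_edges_iff)
  show ?thesis
    unfolding Forb_def triangle_free_def mem_Collect_eq
      induced_three_vertices_iff[OF G is_graph_complete K(1)]
    using True K E by blast
qed (simp add: Forb_def)

text \<open>The centre is 0 and the leaves are 1 and 2, so the vertex matched with 0 is the
  \<open>x\<close> of \<open>cluster\<close>.\<close>

lemma Forb_complete_bipartite_1_2_iff:
  "G \<in> Forb n (complete_bipartite_graph 1 2) \<longleftrightarrow> G \<in> graphs_of_order n \<and> cluster (edges G)"
proof (cases "G \<in> graphs_of_order n")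
  case True
  then have G: "is_graph G" by (simp add: graphs_of_order_def)
  then have E: "{x, y} \<in> edges G \<Longrightarrow> x \<in> verts G \<and> y \<in> verts G \<and> x \<noteq> y" for x y
    by (metis is_graph_def pair_in_all_edges_iff subsetD)
  have K: "verts (complete_bipartite_graph 1 2) = {..<3}"
    "{0, 1} \<in> edges (complete_bipartite_graph 1 2)"
    "{0, 2} \<in> edges (complete_bipartite_graph 1 2)"
    "{1, 2} \<notin> edges (complete_bipartite_graph 1 2)"
    unfolding complete_bipartite_graph_def by (auto simp: doubleton_eq_iff)
  show ?thesis
    unfolding Forb_def cluster_def mem_Collect_eq
      induced_three_vertices_iff[OF G is_graph_complete_bipartite K(1)]
    using True K E by blast
qed (simp add: Forb_def)

section \<open>Distances\<close>

text \<open>The max-min value as two bounds, free of \<open>Min\<close> and \<open>Max\<close>: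
  every graph is within \<open>k\<close> of the family, and some graph is no closer than
  \<open>k\<close>.\<close>

definition extremal_distance :: "nat \<Rightarrow> nat ugraph \<Rightarrow> nat \<Rightarrow> bool" where
  "extremal_distance n H k \<longleftrightarrow>
    (\<forall>G :: nat ugraph. G \<in> graphs_of_order n \<longrightarrow>
      (\<exists>G' \<in> Forb n H. verts G' = verts G \<and> card (sym_diff (edges G) (edges G')) \<le> k)) \<and>
    (\<exists>G :: nat ugraph. G \<in> graphs_of_order n \<and>
      (\<forall>G' \<in> Forb n H. verts G' = verts G \<longrightarrow> k \<le> card (sym_diff (edges G) (edges G'))))"

lemma Forb_is_graph: "G \<in> Forb n H \<Longrightarrow> is_graph G"
  by (simp add: Forb_def graphs_of_order_def)

lemma extremal_distance_complement:
  assumes "extremal_distance n H k" "is_graph H"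
  shows "extremal_distance n (complement_graph H) k"
proof -
  have "\<exists>G' \<in> Forb n (complement_graph H). verts G' = verts G \<and>
      card (sym_diff (edges G) (edges G')) \<le> k"
    if G: "G \<in> graphs_of_order n" for G :: "nat ugraph"
  proof -
    have g: "is_graph G" using G by (simp add: graphs_of_order_def)
    obtain G' where G': "G' \<in> Forb n H" "verts G' = verts G"
      "card (sym_diff (edges (complement_graph G)) (edges G')) \<le> k"
      using assms(1) complement_in_graphs_of_order[OF G]
      unfolding extremal_distance_def by (metis verts_complement)
    have "sym_diff (edges G) (edges (complement_graph G'))
        = sym_diff (edges (complement_graph G)) (edges G')"
      using sym_diff_complement[of "complement_graph G" G'] g G' Forb_is_graph
      by (metis complement_complement is_graph_complement verts_complement)
    then show ?thesis
      using G' complement_in_Forb[OF G'(1) assms(2)] by (intro bexI[of _ "complement_graph G'"]) auto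
  qed
  moreover obtain G :: "nat ugraph" where G: "G \<in> graphs_of_order n"
    "\<And>G'. G' \<in> Forb n H \<Longrightarrow> verts G' = verts G \<Longrightarrow> k \<le> card (sym_diff (edges G) (edges G'))"
    using assms(1) unfolding extremal_distance_def by blast
  have "k \<le> card (sym_diff (edges (complement_graph G)) (edges G'))"
    if "G' \<in> Forb n (complement_graph H)" "verts G' = verts G" for G' :: "nat ugraph"
  proof -
    have "complement_graph G' \<in> Forb n H"
      using complement_in_Forb[OF that(1)] assms(2)
      by (simp add: complement_complement is_graph_complement)
    then have "k \<le> card (sym_diff (edges G) (edges (complement_graph G')))"
      using G(2) that(2) by simp
    moreover have "is_graph G" using G(1) by (simp add: graphs_of_order_def)
    ultimately show ?thesis
      using sym_diff_complement[of G "complement_graph G'"] that Forb_is_graph[OF that(1)]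
      by (simp add: complement_complement is_graph_complement)
  qed
  then have "\<exists>G :: nat ugraph. G \<in> graphs_of_order n \<and>
      (\<forall>G' \<in> Forb n (complement_graph H). verts G' = verts G \<longrightarrow>
        k \<le> card (sym_diff (edges G) (edges G')))"
    \<comment> \<open>The complement of an extremal graph for \<open>H\<close> is extremal for the
      complement of \<open>H\<close>.\<close>
    using complement_in_graphs_of_order[OF G(1)] by (intro exI[of _ "complement_graph G"]) simp
  ultimately show ?thesis unfolding extremal_distance_def by blast
qed

section \<open>The two base cases and their extremal graphs\<close>

lemma extremal_distance_complete_3:
  "extremal_distance n (complete_graph 3) (halves_choose_two n)"
  unfolding extremal_distance_def
proof (intro conjI allI impI)
  fix G :: "nat ugraph" assume "G \<in> graphs_of_order n"
  then have G: "finite (verts G)" "edges G \<subseteq> all_edges (verts G)" "card (verts G) = n"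
    by (auto simp: graphs_of_order_def is_graph_def)
  obtain E' where "E' \<subseteq> all_edges (verts G)" "triangle_free E'"
    "card (sym_diff (edges G) E') \<le> halves_choose_two n"
    using triangle_free_upper[OF G(1,2)] G(3) by metis
  then show "\<exists>G' \<in> Forb n (complete_graph 3). verts G' = verts G \<and>
      card (sym_diff (edges G) (edges G')) \<le> halves_choose_two n"
    using G by (intro bexI[of _ "\<lparr>verts = verts G, edges = E'\<rparr>"])
      (auto simp: Forb_complete_3_iff graphs_of_order_def is_graph_def)
next
  \<comment> \<open>From the complete graph only deletions are possible, so the changes are the
    non-edges of \<open>G'\<close>.\<close>
  have "halves_choose_two n \<le> card (sym_diff (edges (complete_graph n)) (edges G'))"
    if "G' \<in> Forb n (complete_graph 3)" "verts G' = verts (complete_graph n)" for G' :: "nat ugraph"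
  proof -
    have G': "edges G' \<subseteq> all_edges {..<n}" "triangle_free (edges G')"
      using that Forb_is_graph[OF that(1)]
      by (simp_all add: Forb_complete_3_iff is_graph_def) (simp add: complete_graph_def)
    then have "sym_diff (edges (complete_graph n)) (edges G') = all_edges {..<n} - edges G'"
      by (auto simp: complete_graph_def)
    then show ?thesis using triangle_free_lower[OF _ G'] by simp
  qed
  then show "\<exists>G :: nat ugraph. G \<in> graphs_of_order n \<and>
      (\<forall>G' \<in> Forb n (complete_graph 3). verts G' = verts G \<longrightarrow>
        halves_choose_two n \<le> card (sym_diff (edges G) (edges G')))"
    by (intro exI[of _ "complete_graph n"])
      (auto simp: graphs_of_order_def is_graph_complete, simp add: complete_graph_def)
qed

lemma extremal_distance_complete_bipartite_1_2:
  "extremal_distance n (complete_bipartite_graph 1 2) (halves_choose_two n)"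
  unfolding extremal_distance_def
proof (intro conjI allI impI)
  fix G :: "nat ugraph" assume "G \<in> graphs_of_order n"
  then have G: "finite (verts G)" "edges G \<subseteq> all_edges (verts G)" "card (verts G) = n"
    by (auto simp: graphs_of_order_def is_graph_def)
  obtain E' where "E' \<subseteq> all_edges (verts G)" "cluster E'"
    "card (sym_diff (edges G) E') \<le> halves_choose_two n"
    using cluster_upper[OF G(1,2)] G(3) by metis
  then show "\<exists>G' \<in> Forb n (complete_bipartite_graph 1 2). verts G' = verts G \<and>
      card (sym_diff (edges G) (edges G')) \<le> halves_choose_two n"
    using G by (intro bexI[of _ "\<lparr>verts = verts G, edges = E'\<rparr>"])
      (auto simp: Forb_complete_bipartite_1_2_iff graphs_of_order_def is_graph_def simp del: One_nat_def)
next
  \<comment> \<open>The first part takes the rounded-up half, as \<open>cluster_lower\<close>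
    requires.\<close>
  define a where "a = (n + 1) div 2"
  define A where "A = {..<a}"
  define B where "B = {a..<n}"
  have "a \<le> n" "n - a = n div 2" unfolding a_def by presburger+
  then have AB: "finite A" "finite B" "A \<inter> B = {}" "card A = (n + 1) div 2" "card B = n div 2"
    "A \<union> B = {..<n}"
    by (auto simp: A_def B_def a_def)
  let ?G = "\<lparr>verts = {..<n}, edges = cross_edges A B\<rparr>"
  have "halves_choose_two n \<le> card (sym_diff (edges ?G) (edges G'))"
    if "G' \<in> Forb n (complete_bipartite_graph 1 2)" "verts G' = verts ?G" for G' :: "nat ugraph"
    using that cluster_lower[OF AB(1-5), of "edges G'"] AB(6)
    by (simp add: Forb_complete_bipartite_1_2_iff graphs_of_order_def is_graph_def del: One_nat_def)
  moreover have "?G \<in> graphs_of_order n"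
    using cross_edges_subset[OF AB(3)] AB(6) by (simp add: graphs_of_order_def is_graph_def)
  ultimately show "\<exists>G :: nat ugraph. G \<in> graphs_of_order n \<and>
      (\<forall>G' \<in> Forb n (complete_bipartite_graph 1 2). verts G' = verts G \<longrightarrow>
        halves_choose_two n \<le> card (sym_diff (edges G) (edges G')))"
    by blast
qed

text \<open>Besides the two bounds, \<open>Min\<close> and \<open>Max\<close> have to be taken over
  finite nonempty sets.\<close>

lemma Dist_eq_extremal_distance:
  assumes "extremal_distance n H k"
  shows "Dist n (Forb n H) = k"
proof -
  define D where "D G = {card (sym_diff (edges G) (edges G')) | G'. G' \<in> Forb n H \<and> verts G' = verts G}"
    for G :: "nat ugraph"
  have DG: "Dist_graph G (Forb n H :: nat ugraph set) = Min (D G)" for G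
  proof -
    have "is_graph G' \<and> (\<exists>F \<in> (Forb n H :: nat ugraph set). isomorphic G' F) \<longleftrightarrow> G' \<in> Forb n H"
      for G' :: "nat ugraph"
      using Forb_isomorphic Forb_is_graph isomorphic_refl by blast
    then have "D G = {card (sym_diff (edges G) (edges G')) | G'.
            is_graph G' \<and> verts G' = verts G \<and> (\<exists>F \<in> (Forb n H :: nat ugraph set). isomorphic G' F)}"
      unfolding D_def by metis
    then show ?thesis by (simp add: Dist_graph_def)
  qed
  have fin: "finite (D G)" if "G \<in> graphs_of_order n" for G
  proof (rule finite_subset)
    \<comment> \<open>All distances from \<open>G\<close> are sizes of sets of pairs of its
      vertices.\<close>
    show "D G \<subseteq> card ` Pow (all_edges (verts G))"
    proof
      fix d assume "d \<in> D G"
      then obtain G' where G': "d = card (sym_diff (edges G) (edges G'))" "G' \<in> Forb n H"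
        "verts G' = verts G" unfolding D_def by blast
      then have "sym_diff (edges G) (edges G') \<subseteq> all_edges (verts G)"
        using that Forb_is_graph[OF G'(2)] by (auto simp: graphs_of_order_def is_graph_def)
      then show "d \<in> card ` Pow (all_edges (verts G))" using G'(1) by blast
    qed
    show "finite (card ` Pow (all_edges (verts G)))"
      using that by (simp add: graphs_of_order_def is_graph_def finite_all_edges)
  qed
  have le: "Min (D G) \<le> k" if ord: "G \<in> graphs_of_order n" for G
  proof -
    obtain G' where G': "G' \<in> Forb n H" "verts G' = verts G"
      "card (sym_diff (edges G) (edges G')) \<le> k"
      using assms[unfolded extremal_distance_def, THEN conjunct1] ord by blast
    then have "card (sym_diff (edges G) (edges G')) \<in> D G" unfolding D_def by blast
    then show ?thesis using Min_le[OF fin[OF ord]] G'(3) le_trans by blast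
  qed
  obtain G :: "nat ugraph" where G: "G \<in> graphs_of_order n"
    "\<And>G'. G' \<in> Forb n H \<Longrightarrow> verts G' = verts G \<Longrightarrow> k \<le> card (sym_diff (edges G) (edges G'))"
    using assms[unfolded extremal_distance_def, THEN conjunct2] by blast
  \<comment> \<open>The upper-bound half of \<open>extremal_distance\<close> supplies a
    member.\<close>
  have "D G \<noteq> {}"
    using assms[unfolded extremal_distance_def, THEN conjunct1] G(1) unfolding D_def by blast
  then have "k \<le> Min (D G)" using fin[OF G(1)] G(2) by (auto simp: D_def)
  then have "Min (D G) = k" using le[OF G(1)] by simp
  then have "k \<in> {Min (D G) | G. G \<in> graphs_of_order n}" using G(1) by blast
  \<comment> \<open>The vertex sets range over all n-subsets of the naturals, so there may be
    infinitely many graphs; finiteness comes from the bound \<open>k\<close> on the values.\<close>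
  moreover have "finite {Min (D G) | G. G \<in> graphs_of_order n}"
    by (rule finite_subset[of _ "{..k}"]) (use le in auto)
  ultimately show ?thesis
    unfolding Dist_def DG using le by (intro Max_eqI) auto
qed

theorem theorem5p1:
  fixes H :: "nat ugraph" and n :: nat
  assumes "H \<in> {complete_graph 3, complement_graph (complete_graph 3),
                complete_bipartite_graph 1 2, complement_graph (complete_bipartite_graph 1 2)}"
    and "0 < n"
  shows "Dist n (Forb n H)
           = (nat \<lceil>real n / 2\<rceil> choose 2) + (nat \<lfloor>real n / 2\<rfloor> choose 2)"
proof -
  \<comment> \<open>Two of the four graphs are the base cases; the other two follow by
    complementation.\<close>
  have "extremal_distance n H (halves_choose_two n)"
    using assms(1) extremal_distance_complete_3 extremal_distance_complete_bipartite_1_2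
      extremal_distance_complement is_graph_complete is_graph_complete_bipartite
    by blast
  then show ?thesis by (simp only: Dist_eq_extremal_distance halves_choose_two_real)
qed

end
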